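(* For every lattice $\Gamma\subset Sol$, the homogeneous space $Sol/\Gamma$ is non-blockable. In particular, for every lattice $\Gamma\subset Sol$, the set of non-blockable pairs $(m_1,m_2)$ is a dense subset of $Sol/\Gamma\times Sol/\Gamma$.
   Context: $Sol$ is the Lie group $\mathbb{R}^2\rtimes\mathbb{R}$, i.e. $\mathbb{R}^3$ with multiplication $(x_1,y_1,z_1)(x_2,y_2,z_2)=(x_1+e^{z_1}x_2,\;y_1+e^{-z_1}y_2,\;z_1+z_2)$. Blocking: Let $G$ be a connected Lie group with Lie algebra $\mathfrak{G}$ and exponential map $\exp:\mathfrak{G}\to G$, let $\Gamma\subset G$ be a lattice, and let $M=G/\Gamma$ (left cosets $g\Gamma$, with $G$ acting by left multiplication, $g\cdot m$). For $m_1,m_2\in M$ (not necessarily distinct), a connecting curve for the pair is a parametrized curve $c(t)=\exp(tx)\cdot m_1$, $0\le t\le 1$, with $x\in\mathfrak{G}$, such that $c(0)=m_1$ and $c(1)=m_2$. A finite set $B\subset M\setminus\{m_1,m_2\}$ is a blocking set for the pair $m_1,m_2$ if $c([0,1])\cap B\ne\emptyset$ for every connecting curve $c$ of the pair. The pair is blockable if a (finite) blocking set exists, and non-blockable otherwise. $M$ is blockable if every pair of its points is blockable, and non-blockable if at least one pair of points is non-blockable. *)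

theory Defs
  imports "HOL-Analysis.Analysis" "HOL-Algebra.Left_Coset"
begin

type_synonym R3 = "real \<times> real \<times> real"

definition Sol :: "R3 monoid" where
  "Sol = \<lparr>carrier = UNIV,
          mult = (\<lambda>(x1, y1, z1) (x2, y2, z2).
                    (x1 + exp z1 * x2, y1 + exp (- z1) * y2, z1 + z2)),
          one = (0, 0, 0)\<rparr>"

lemma Sol_carrier [simp]: "carrier Sol = UNIV"
  and Sol_one [simp]: "\<one>\<^bsub>Sol\<^esub> = (0, 0, 0)"
  and Sol_mult [simp]: "(x1, y1, z1) \<otimes>\<^bsub>Sol\<^esub> (x2, y2, z2) =
    (x1 + exp z1 * x2, y1 + exp (- z1) * y2, z1 + z2)"
  by (simp_all add: Sol_def)

lemma group_Sol: "group Sol"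
proof (rule groupI)
  fix g :: R3
  assume "g \<in> carrier Sol"
  obtain x y z where g: "g = (x, y, z)"
    by (cases g)
  have "(- exp (- z) * x, - exp z * y, - z) \<otimes>\<^bsub>Sol\<^esub> g = \<one>\<^bsub>Sol\<^esub>"
    by (simp add: g)
  then show "\<exists>h\<in>carrier Sol. h \<otimes>\<^bsub>Sol\<^esub> g = \<one>\<^bsub>Sol\<^esub>"
    by (metis UNIV_I Sol_carrier)
qed (auto simp: algebra_simps exp_add exp_diff exp_minus divide_inverse)

text \<open>
  The underlying manifold of Sol is the vector space \<open>R3\<close>, so its Lie algebra (the tangent
  space at the identity) is again \<open>R3\<close>. A homomorphism from the reals that is differentiable
  at \<open>0\<close> is automatically smooth.
\<close>

definition one_parameter_subgroup :: "R3 \<Rightarrow> (real \<Rightarrow> R3) \<Rightarrow> bool" where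
  "one_parameter_subgroup v \<phi> \<longleftrightarrow>
     (\<forall>s t. \<phi> (s + t) = \<phi> s \<otimes>\<^bsub>Sol\<^esub> \<phi> t) \<and> (\<phi> has_vector_derivative v) (at 0)"

definition Sol_exp :: "R3 \<Rightarrow> R3" where
  "Sol_exp v = (THE \<phi>. one_parameter_subgroup v \<phi>) 1"

lemma has_real_derivative_cocycle:
  fixes f E :: "real \<Rightarrow> real"
  assumes "\<And>s t. f (s + t) = f s + E s * f t" and f: "(f has_real_derivative v) (at 0)"
  shows "(f has_real_derivative E s * v) (at s)"
proof -
  have eq: "f = (\<lambda>t. f s + E s * f (t - s))"
  proof
    show "f t = f s + E s * f (t - s)" for t
      using assms(1)[of s "t - s"] by simp
  qed
  have "((\<lambda>t. f (t - s)) has_real_derivative v) (at s)"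
    using f DERIV_shift[of f v s "- s"] by simp
  then have "((\<lambda>t. f s + E s * f (t - s)) has_real_derivative E s * v) (at s)"
    by (auto intro!: derivative_eq_intros)
  then show ?thesis
    by (simp only: eq[symmetric])
qed

lemma cocycle_unique:
  fixes f g E :: "real \<Rightarrow> real"
  assumes "\<And>s t. f (s + t) = f s + E s * f t" "(f has_real_derivative v) (at 0)"
    and "\<And>s t. g (s + t) = g s + E s * g t" "(g has_real_derivative v) (at 0)"
    and "f 0 = 0" "g 0 = 0"
  shows "f t = g t"
proof -
  have "((\<lambda>t. f t - g t) has_real_derivative 0) (at s within UNIV)" for s
    using DERIV_diff[OF has_real_derivative_cocycle[OF assms(1,2)]
        has_real_derivative_cocycle[OF assms(3,4)], of s] by simp
  then obtain c where "\<And>t. f t - g t = c"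
    using has_field_derivative_zero_constant[of UNIV "\<lambda>t. f t - g t"] by auto
  from this[of t] this[of 0] show ?thesis
    using assms(5,6) by simp
qed

lemma one_parameter_subgroup_iff:
  "one_parameter_subgroup (x, y, z) (\<lambda>t. (a t, b t, c t)) \<longleftrightarrow>
     (\<forall>s t. a (s + t) = a s + exp (c s) * a t) \<and>
     (\<forall>s t. b (s + t) = b s + exp (- c s) * b t) \<and>
     (\<forall>s t. c (s + t) = c s + c t) \<and>
     (a has_real_derivative x) (at 0) \<and> (b has_real_derivative y) (at 0) \<and>
     (c has_real_derivative z) (at 0)"
proof -
  have components: "(f has_vector_derivative fst v) (at r) \<and> (g has_vector_derivative snd v) (at r)"
    if "((\<lambda>t. (f t, g t)) has_vector_derivative v) (at r)"
    for f :: "real \<Rightarrow> 'a::real_normed_vector" and g :: "real \<Rightarrow> 'b::real_normed_vector" and v r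
    using bounded_linear.has_vector_derivative[OF bounded_linear_fst that]
      bounded_linear.has_vector_derivative[OF bounded_linear_snd that] by simp
  have pair: "((\<lambda>t. (f t, g t)) has_vector_derivative (u, v)) (at r) \<longleftrightarrow>
      (f has_vector_derivative u) (at r) \<and> (g has_vector_derivative v) (at r)"
    for f :: "real \<Rightarrow> 'a::real_normed_vector" and g :: "real \<Rightarrow> 'b::real_normed_vector" and u v r
    using components[of f g "(u, v)" r] has_vector_derivative_Pair[of f u r UNIV] by auto
  show ?thesis
    unfolding one_parameter_subgroup_def
    by (auto simp: pair has_real_derivative_iff_has_vector_derivative)
qed

lemma one_parameter_subgroup_unique:
  assumes "one_parameter_subgroup v \<phi>" "one_parameter_subgroup v \<psi>"
  shows "\<phi> = \<psi>"
proof -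
  obtain x y z where v: "v = (x, y, z)"
    by (cases v)
  have split: "\<exists>a b c. \<rho> = (\<lambda>t. (a t, b t, c t))" for \<rho> :: "real \<Rightarrow> R3"
    by (rule exI[of _ "\<lambda>t. fst (\<rho> t)"], rule exI[of _ "\<lambda>t. fst (snd (\<rho> t))"],
        rule exI[of _ "\<lambda>t. snd (snd (\<rho> t))"]) simp
  obtain a b c where \<phi>: "\<phi> = (\<lambda>t. (a t, b t, c t))"
    using split by blast
  obtain a' b' c' where \<psi>: "\<psi> = (\<lambda>t. (a' t, b' t, c' t))"
    using split by blast
  note * = assms[unfolded v \<phi> \<psi> one_parameter_subgroup_iff]
  have c0: "c 0 = 0" "c' 0 = 0"
  proof -
    have "c (0 + 0) = c 0 + c 0" "c' (0 + 0) = c' 0 + c' 0"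
      using * by blast+
    then show "c 0 = 0" "c' 0 = 0"
      by simp_all
  qed
  have c: "c = c'"
  proof
    show "c t = c' t" for t
      by (rule cocycle_unique[of c "\<lambda>_. 1" z c']) (use * c0 in auto)
  qed
  have 0: "a 0 = 0" "a' 0 = 0" "b 0 = 0" "b' 0 = 0"
  proof -
    have "a (0 + 0) = a 0 + exp (c 0) * a 0" "a' (0 + 0) = a' 0 + exp (c' 0) * a' 0"
      "b (0 + 0) = b 0 + exp (- c 0) * b 0" "b' (0 + 0) = b' 0 + exp (- c' 0) * b' 0"
      using * by blast+
    then show "a 0 = 0" "a' 0 = 0" "b 0 = 0" "b' 0 = 0"
      using c0 by simp_all
  qed
  have "a t = a' t" for t
    by (rule cocycle_unique[of a "\<lambda>s. exp (c s)" x a']) (use * 0 c in auto)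
  moreover have "b t = b' t" for t
    by (rule cocycle_unique[of b "\<lambda>s. exp (- c s)" y b']) (use * 0 c in auto)
  ultimately show ?thesis
    by (simp add: \<phi> \<psi> c)
qed

definition exp_integral :: "real \<Rightarrow> real \<Rightarrow> real" where
  "exp_integral z t = (if z = 0 then t else (exp (t * z) - 1) / z)"

lemma one_parameter_subgroup_exists:
  "one_parameter_subgroup (x, y, z)
     (\<lambda>t. (x * exp_integral z t, y * exp_integral (- z) t, t * z))"
proof -
  have cocycle: "exp_integral w (s + t) = exp_integral w s + exp (s * w) * exp_integral w t" for w s t
    by (simp add: exp_integral_def field_simps exp_add)
  have deriv: "(exp_integral w has_real_derivative 1) (at 0)" for w
    unfolding exp_integral_def by (cases "w = 0") (auto intro!: derivative_eq_intros)
  show ?thesis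
    unfolding one_parameter_subgroup_iff using cocycle[of z] cocycle[of "- z"]
    by (auto simp: algebra_simps intro!: derivative_eq_intros deriv)
qed

lemma Sol_exp_eq:
  "Sol_exp (x, y, z) = (x * exp_integral z 1, y * exp_integral (- z) 1, z)"
proof -
  have "(THE \<phi>. one_parameter_subgroup (x, y, z) \<phi>) =
      (\<lambda>t. (x * exp_integral z t, y * exp_integral (- z) t, t * z))"
    by (rule the_equality) (use one_parameter_subgroup_exists one_parameter_subgroup_unique in blast)+
  then show ?thesis
    by (simp add: Sol_exp_def)
qed

definition quotient_topology :: "R3 set \<Rightarrow> R3 set topology" where
  "quotient_topology \<Gamma> =
     topology (\<lambda>U. U \<subseteq> lcosets\<^bsub>Sol\<^esub> \<Gamma> \<and> open {g. g <#\<^bsub>Sol\<^esub> \<Gamma> \<in> U})"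

lemma openin_quotient_topology:
  "openin (quotient_topology \<Gamma>) U \<longleftrightarrow>
     U \<subseteq> lcosets\<^bsub>Sol\<^esub> \<Gamma> \<and> open {g. g <#\<^bsub>Sol\<^esub> \<Gamma> \<in> U}"
proof -
  have "open {g. g <#\<^bsub>Sol\<^esub> \<Gamma> \<in> \<Union>\<K>}" if "\<forall>K\<in>\<K>. open {g. g <#\<^bsub>Sol\<^esub> \<Gamma> \<in> K}" for \<K>
  proof -
    have "{g. g <#\<^bsub>Sol\<^esub> \<Gamma> \<in> \<Union>\<K>} = (\<Union>K\<in>\<K>. {g. g <#\<^bsub>Sol\<^esub> \<Gamma> \<in> K})"
      by auto
    then show ?thesis
      using that by auto
  qed
  then have "istopology (\<lambda>U. U \<subseteq> lcosets\<^bsub>Sol\<^esub> \<Gamma> \<and> open {g. g <#\<^bsub>Sol\<^esub> \<Gamma> \<in> U})"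
    unfolding istopology_def by (auto simp: Collect_conj_eq)
  then show ?thesis
    by (simp add: quotient_topology_def)
qed

lemma topspace_quotient_topology [simp]:
  "topspace (quotient_topology \<Gamma>) = lcosets\<^bsub>Sol\<^esub> \<Gamma>"
proof -
  have "{g. g <#\<^bsub>Sol\<^esub> \<Gamma> \<in> lcosets\<^bsub>Sol\<^esub> \<Gamma>} = UNIV"
    by (auto simp: LCOSETS_def)
  then have "openin (quotient_topology \<Gamma>) (lcosets\<^bsub>Sol\<^esub> \<Gamma>)"
    by (simp add: openin_quotient_topology)
  then show ?thesis
    by (auto simp: topspace_def openin_quotient_topology)
qed

text \<open>
  For a coset \<open>m\<close>, the set \<open>g <#\<^bsub>Sol\<^esub> m\<close> is the translate of \<open>m\<close> by \<open>g\<close>. A lattice is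
  a discrete subgroup whose quotient carries a nonzero finite invariant Borel measure.
\<close>

definition Sol_lattice :: "R3 set \<Rightarrow> bool" where
  "Sol_lattice \<Gamma> \<longleftrightarrow>
     subgroup \<Gamma> Sol \<and> discrete \<Gamma> \<and>
     (\<exists>\<mu>. space \<mu> = lcosets\<^bsub>Sol\<^esub> \<Gamma> \<and>
          sets \<mu> = sigma_sets (lcosets\<^bsub>Sol\<^esub> \<Gamma>) {U. openin (quotient_topology \<Gamma>) U} \<and>
          0 < emeasure \<mu> (space \<mu>) \<and> emeasure \<mu> (space \<mu>) < \<infinity> \<and>
          (\<forall>g. \<forall>A\<in>sets \<mu>. emeasure \<mu> ((\<lambda>m. g <#\<^bsub>Sol\<^esub> m) ` A) = emeasure \<mu> A))"

definition connecting_curve :: "R3 set \<Rightarrow> R3 set \<Rightarrow> (real \<Rightarrow> R3 set) \<Rightarrow> bool" where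
  "connecting_curve m1 m2 c \<longleftrightarrow>
     (\<exists>v. \<forall>t\<in>{0..1}. c t = Sol_exp (t *\<^sub>R v) <#\<^bsub>Sol\<^esub> m1) \<and> c 0 = m1 \<and> c 1 = m2"

definition blocking_set :: "R3 set \<Rightarrow> R3 set \<Rightarrow> R3 set \<Rightarrow> R3 set set \<Rightarrow> bool" where
  "blocking_set \<Gamma> m1 m2 B \<longleftrightarrow>
     finite B \<and> B \<subseteq> lcosets\<^bsub>Sol\<^esub> \<Gamma> - {m1, m2} \<and>
     (\<forall>c. connecting_curve m1 m2 c \<longrightarrow> c ` {0..1} \<inter> B \<noteq> {})"

definition blockable_pair :: "R3 set \<Rightarrow> R3 set \<Rightarrow> R3 set \<Rightarrow> bool" where
  "blockable_pair \<Gamma> m1 m2 \<longleftrightarrow> (\<exists>B. blocking_set \<Gamma> m1 m2 B)"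

definition blockable :: "R3 set \<Rightarrow> bool" where
  "blockable \<Gamma> \<longleftrightarrow>
     (\<forall>m1\<in>lcosets\<^bsub>Sol\<^esub> \<Gamma>. \<forall>m2\<in>lcosets\<^bsub>Sol\<^esub> \<Gamma>. blockable_pair \<Gamma> m1 m2)"

end

(*
  Right translation by the inverse of a representative reduces a pair to (G, h G) for a conjugate G of
  the lattice. Away from height 0
  every element of Sol lies on exactly one one-parameter subgroup, so the elements h g (g in G)
  index connecting curves. The lattice contains elements of infinitely many different heights; by the
  pigeonhole principle it suffices that for a dense set of endpoints h no two curves with different
  end heights meet modulo the lattice at interior times. For each of the countably many triples of
  lattice elements this is a condition of codimension one: with p = exp (t Z) the two horizontal
  equations are affine in p and in 1/p, and eliminating p leaves one nontrivial relation in the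
  coordinates of h.
*)

theory Submission
  imports Defs
begin

section \<open>Countability of discrete sets\<close>

lemma countable_if_subsingleton:
  assumes "\<And>a b. a \<in> S \<Longrightarrow> b \<in> S \<Longrightarrow> a = b"
  shows "countable S"
proof (cases "S = {}")
  case False
  then obtain a where "a \<in> S"
    by blast
  then have "S \<subseteq> {a}"
    using assms by blast
  then show ?thesis
    by (meson countable_empty countable_insert countable_subset)
qed simp

text \<open>Choosing for each point a basic open set that isolates it gives an injection into a
  countable basis. For a lattice, this leaves only countably many meeting conditions to
  avoid.\<close>

lemma countable_discrete:
  fixes S :: "'a::second_countable_topology set"
  assumes "discrete S"
  shows "countable S"
proof -
  obtain B :: "'a set set" where B: "countable B" "topological_basis B"
    using ex_countable_basis by blast
  have "\<exists>b\<in>B. b \<inter> S = {x}" if x: "x \<in> S" for x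
  proof -
    obtain T where T: "open T" "T \<inter> S = {x}"
      using assms x unfolding discrete_def isolated_in_def by blast
    then obtain b where "b \<in> B" "x \<in> b" "b \<subseteq> T"
      using topological_basisE[OF B(2) T(1), of x] by blast
    then show ?thesis
      using T(2) x by blast
  qed
  then obtain f where f: "\<And>x. x \<in> S \<Longrightarrow> f x \<in> B" "\<And>x. x \<in> S \<Longrightarrow> f x \<inter> S = {x}"
    by metis
  have "inj_on f S"
    by (rule inj_onI) (metis f(2) singleton_inject)
  moreover have "countable (f ` S)"
    by (rule countable_subset[OF _ B(1)]) (use f(1) in blast)
  ultimately show ?thesis
    by (rule countable_image_inj_on[rotated])
qed

section \<open>Equations for two curves to meet\<close>

text \<open>Each quotient in the second equation is \<open>P / q\<close> times its counterpart in
  the first, so together they force \<open>P2 = k * P1\<close>. The first then reads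
  \<open>(1 - k) * (p - P1) = 0\<close>, and \<open>k = 1\<close> would give \<open>P1 = P2\<close>.
  Hence at an admissible \<open>p\<close> the unknowns \<open>x\<close> and \<open>y\<close> cannot
  both drop out of the meeting equations.\<close>

lemma meeting_coefficients_nonzero:
  fixes P1 P2 k p :: real
  assumes "P1 \<noteq> P2" "P1 \<noteq> 1" "P2 \<noteq> 1" "P1 > 0" "P2 > 0" "k > 0" "p > 0" "p \<noteq> 1" "p \<noteq> P1"
    and x: "(1 - p) / (1 - P1) = (1 - p * k) / (1 - P2)"
    and y: "(1 - 1 / p) / (1 - 1 / P1) = (1 - 1 / (p * k)) / (1 - 1 / P2)"
  shows False
proof -
  have x': "(1 - p) * (1 - P2) = (1 - p * k) * (1 - P1)"
    using x assms(1-9) by (simp add: frac_eq_eq)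
  have inv: "(1 - 1 / q) / (1 - 1 / P) = (P / q) * ((1 - q) / (1 - P))"
    if "q > 0" "P > 0" "P \<noteq> 1" for q P :: real
    using that by (simp add: divide_simps) (simp add: algebra_simps)
  have "(P1 / p) * ((1 - p) / (1 - P1)) = (P2 / (p * k)) * ((1 - p) / (1 - P1))"
    using y inv[of p P1] inv[of "p * k" P2] x assms(1-9) by simp
  moreover have "(1 - p) / (1 - P1) \<noteq> 0"
    using assms(1-9) by simp
  ultimately have "P1 / p = P2 / (p * k)"
    by (metis mult_right_cancel)
  then have P2: "P2 = k * P1"
    using assms(1-9) by (simp add: field_simps)
  have "(1 - k) * (p - P1) = 0"
    using x' unfolding P2 by (simp add: algebra_simps)
  then show False
    using assms P2 by auto
qed

text \<open>
  Two curves with different end heights meet when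
  \<open>(x + a1) (1 - p) / (1 - P1) + p d = (x + a2) (1 - p k) / (1 - P2)\<close> and the analogous
  equation for the contracting coordinate hold. The first is affine in \<open>x\<close> and in \<open>p\<close>, so for \<open>x\<close> outside
  a countable set it determines a \<open>p\<close> for which the second
  one determines \<open>y\<close>.
\<close>

lemma countable_exceptional_values:
  fixes P1 P2 k a1 a2 b1 b2 d e :: real
  assumes P: "P1 \<noteq> P2" "P1 \<noteq> 1" "P2 \<noteq> 1" "P1 > 0" "P2 > 0" "k > 0"
  defines "ex \<equiv> \<lambda>x p. (x + a1) * ((1 - p) / (1 - P1)) + p * d = (x + a2) * ((1 - p * k) / (1 - P2))"
    and "ey \<equiv> \<lambda>y p. (y + b1) * ((1 - 1 / p) / (1 - 1 / P1)) + e / p =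
                  (y + b2) * ((1 - 1 / (p * k)) / (1 - 1 / P2))"
  shows "\<exists>X. countable X \<and> (\<forall>x. x \<notin> X \<longrightarrow>
           countable {y. \<exists>p. p > 0 \<and> p \<noteq> 1 \<and> p \<noteq> P1 \<and> ex x p \<and> ey y p})"
proof -
  \<comment> \<open>\<open>cx p\<close> and \<open>cy p\<close> are the net coefficients of
    \<open>x\<close> in \<open>ex\<close> and of \<open>y\<close> in \<open>ey\<close>.\<close>
  define cx where "cx p = (1 - p) / (1 - P1) - (1 - p * k) / (1 - P2)" for p
  define cy where "cy p = (1 - 1 / p) / (1 - 1 / P1) - (1 - 1 / (p * k)) / (1 - 1 / P2)" for p
  define ok where "ok p \<longleftrightarrow> p > 0 \<and> p \<noteq> 1 \<and> p \<noteq> P1" for p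
  have coeff: "cx p \<noteq> 0 \<or> cy p \<noteq> 0" if "ok p" for p
    using meeting_coefficients_nonzero[OF P] that unfolding cx_def cy_def ok_def by auto
  have affine_unique: "x = x'"
    if "(x + a) * M + c = (x + b) * N" "(x' + a) * M + c = (x' + b) * N" "M - N \<noteq> 0"
    for x x' a b c M N :: real
  proof -
    have "(x - x') * (M - N) = 0"
      using that(1,2) by (simp add: algebra_simps)
    then show ?thesis
      using that(3) by simp
  qed
  have x_unique: "x = x'" if "ex x p" "ex x' p" "cx p \<noteq> 0" for x x' p
    using that unfolding ex_def cx_def by (rule affine_unique)
  have y_unique: "y = y'" if "ey y p" "ey y' p" "cy p \<noteq> 0" for y y' p
    using that unfolding ey_def cy_def by (rule affine_unique)
  \<comment> \<open>\<open>cy\<close> is affine in \<open>1 / p\<close> with nonzero constant term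
    \<open>U - W\<close>, so a root forces a nonzero slope and is unique.\<close>
  have cy_root_unique: "p = p'" if p: "cy p = 0" "cy p' = 0" "ok p" "ok p'" for p p'
  proof -
    define U W where "U = 1 / (1 - 1 / P1)" and "W = 1 / (1 - 1 / P2)"
    have "U \<noteq> W"
      using P unfolding U_def W_def by (simp add: field_simps)
    have "(U - W) + (W / k - U) * (1 / q) = cy q" for q
      unfolding cy_def U_def W_def by (simp add: divide_inverse algebra_simps)
    then have "(U - W) + (W / k - U) * (1 / p) = 0" "(U - W) + (W / k - U) * (1 / p') = 0"
      using p by auto
    then have "(W / k - U) * (1 / p) = (W / k - U) * (1 / p')" "W / k - U \<noteq> 0"
      using \<open>U \<noteq> W\<close> by (linarith, auto)
    then show ?thesis
      by (simp add: divide_inverse)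
  qed
  \<comment> \<open>\<open>f x\<close> is the constant term in \<open>p\<close> of the difference of
    the two sides of \<open>ex\<close>. If it is nonzero, a solution \<open>p\<close> forces a
    nonzero slope and is unique.\<close>
  define f where "f x = (x + a1) / (1 - P1) - (x + a2) / (1 - P2)" for x
  have p_unique: "p = p'" if p: "ex x p" "ex x p'" "f x \<noteq> 0" for x p p'
  proof -
    define g where "g = - (x + a1) / (1 - P1) + d + k * (x + a2) / (1 - P2)"
    have eq: "f x + g * q = 0" if "ex x q" for q
      using that unfolding ex_def f_def g_def by (simp add: divide_inverse algebra_simps)
    then have "g * p = g * p'" "g \<noteq> 0"
      using eq[OF p(1)] eq[OF p(2)] p(3) by (linarith, auto)
    then show ?thesis
      by simp
  qed
  have f_root_unique: "x = x'" if "f x = 0" "f x' = 0" for x x'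
  proof -
    have "(x - x') * (1 / (1 - P1) - 1 / (1 - P2)) = f x - f x'"
      unfolding f_def by (simp add: divide_inverse algebra_simps)
    moreover have "1 / (1 - P1) \<noteq> 1 / (1 - P2)"
      using P by (simp add: field_simps)
    ultimately show ?thesis
      using that by simp
  qed
  \<comment> \<open>Outside the first set \<open>x\<close> determines \<open>p\<close>; outside the
    second this \<open>p\<close> determines \<open>y\<close>. The second set has at most one
    element: \<open>cy\<close> has at most one admissible root, and there \<open>cx\<close> is
    nonzero, so \<open>ex\<close> fixes \<open>x\<close>.\<close>
  define X where "X = {x. f x = 0} \<union> {x. \<exists>p. ok p \<and> cy p = 0 \<and> ex x p}"
  have "countable {x. f x = 0}"
    by (rule countable_if_subsingleton) (use f_root_unique in blast)
  moreover have "countable {x. \<exists>p. ok p \<and> cy p = 0 \<and> ex x p}"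
  proof (rule countable_if_subsingleton)
    fix x x' assume "x \<in> {x. \<exists>p. ok p \<and> cy p = 0 \<and> ex x p}" "x' \<in> {x. \<exists>p. ok p \<and> cy p = 0 \<and> ex x p}"
    then obtain p p' where "ok p" "cy p = 0" "ex x p" "ok p'" "cy p' = 0" "ex x' p'"
      by blast
    moreover from this have "p = p'"
      using cy_root_unique by blast
    ultimately show "x = x'"
      using x_unique coeff by blast
  qed
  ultimately have "countable X"
    unfolding X_def by blast
  moreover have "countable {y. \<exists>p. p > 0 \<and> p \<noteq> 1 \<and> p \<noteq> P1 \<and> ex x p \<and> ey y p}"
    if "x \<notin> X" for x
  proof (rule countable_if_subsingleton)
    fix y y' assume "y \<in> {y. \<exists>p. p > 0 \<and> p \<noteq> 1 \<and> p \<noteq> P1 \<and> ex x p \<and> ey y p}"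
      "y' \<in> {y. \<exists>p. p > 0 \<and> p \<noteq> 1 \<and> p \<noteq> P1 \<and> ex x p \<and> ey y p}"
    then obtain p p' where "ok p" "ex x p" "ey y p" "ok p'" "ex x p'" "ey y' p'"
      unfolding ok_def by blast
    moreover from this have "p = p'"
      using p_unique that unfolding X_def by blast
    moreover from calculation have "cy p \<noteq> 0"
      using that unfolding X_def by blast
    ultimately show "y = y'"
      using y_unique by blast
  qed
  ultimately show ?thesis
    by blast
qed

section \<open>Explicit one-parameter subgroups and generic endpoints\<close>

text \<open>
  For \<open>Z = 0\<close> the divisions make \<open>sol_chord\<close> meaningless; otherwise it is the one-parameter
  subgroup through the given element, parametrised to reach it at time 1.
\<close>

fun sol_chord :: "R3 \<Rightarrow> real \<Rightarrow> R3" where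
  "sol_chord (X, Y, Z) t = (X * ((1 - exp (t * Z)) / (1 - exp Z)),
     Y * ((1 - 1 / exp (t * Z)) / (1 - 1 / exp Z)), t * Z)"

lemma Sol_exp_sol_chord:
  assumes "snd (snd g) \<noteq> 0"
  obtains v where "\<And>t. Sol_exp (t *\<^sub>R v) = sol_chord g t" "Sol_exp (0 *\<^sub>R v) = \<one>\<^bsub>Sol\<^esub>"
    "Sol_exp (1 *\<^sub>R v) = g"
proof -
  obtain X Y Z where g: "g = (X, Y, Z)"
    by (cases g)
  with assms have Z: "Z \<noteq> 0"
    by simp
  \<comment> \<open>Normalised so that \<open>a * (1 - exp (t * Z))\<close> and
    \<open>b * (1 - 1 / exp (t * Z))\<close> reach \<open>X\<close> and \<open>Y\<close> at
    \<open>t = 1\<close>; \<open>v\<close> collects the derivatives at \<open>t = 0\<close>.\<close>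
  define a b where "a = X / (1 - exp Z)" and "b = Y / (1 - 1 / exp Z)"
  define v where "v = (- a * Z, b * Z, Z)"
  \<comment> \<open>Multiplying by \<open>w\<close> absorbs the case split in
    \<open>exp_integral\<close>, so \<open>t = 0\<close> needs no separate treatment.\<close>
  have ei: "w * exp_integral w 1 = exp w - 1" for w
    by (simp add: exp_integral_def)
  have chord: "Sol_exp (t *\<^sub>R v) = sol_chord g t" for t
  proof -
    have "(t * (- a * Z)) * exp_integral (t * Z) 1 = - a * (t * Z * exp_integral (t * Z) 1)"
      by simp
    also have "\<dots> = a * (1 - exp (t * Z))"
      unfolding ei by (simp add: algebra_simps)
    finally have x: "(t * (- a * Z)) * exp_integral (t * Z) 1 = X * ((1 - exp (t * Z)) / (1 - exp Z))"
      by (simp add: a_def)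
    have "(t * (b * Z)) * exp_integral (- (t * Z)) 1 = - b * (- (t * Z) * exp_integral (- (t * Z)) 1)"
      by simp
    also have "\<dots> = b * (1 - 1 / exp (t * Z))"
      unfolding ei by (simp add: algebra_simps exp_minus inverse_eq_divide)
    finally have y: "(t * (b * Z)) * exp_integral (- (t * Z)) 1 =
        Y * ((1 - 1 / exp (t * Z)) / (1 - 1 / exp Z))"
      by (simp add: b_def)
    show ?thesis
      using x y by (simp add: v_def g Sol_exp_eq)
  qed
  have "sol_chord g 0 = \<one>\<^bsub>Sol\<^esub>" "sol_chord g 1 = g"
    using Z by (simp_all add: g)
  with chord show ?thesis
    using that by metis
qed

text \<open>The coordinates of \<open>h\<close> are chosen in the order \<open>z\<close>,
  \<open>x\<close>, \<open>y\<close>, each from a nonempty open set of reals minus a countable set.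
  The choice of \<open>z\<close> makes all end heights nonzero, \<open>x\<close> avoids the
  exceptional values of every triple, and \<open>y\<close> avoids the values that still allow a
  meeting. The factor \<open>\<delta>\<close> expresses meeting modulo \<open>G\<close>.\<close>

lemma exists_generic_endpoint:
  fixes G U :: "R3 set"
  assumes "countable G" "open U" "U \<noteq> {}"
  obtains h where "h \<in> U" "\<And>\<gamma>. \<gamma> \<in> G \<Longrightarrow> snd (snd (h \<otimes>\<^bsub>Sol\<^esub> \<gamma>)) \<noteq> 0"
    "\<And>\<gamma>1 \<gamma>2 \<delta> s t. \<gamma>1 \<in> G \<Longrightarrow> \<gamma>2 \<in> G \<Longrightarrow> \<delta> \<in> G \<Longrightarrow> snd (snd \<gamma>1) \<noteq> snd (snd \<gamma>2) \<Longrightarrow> 0 < s \<Longrightarrow> s < 1 \<Longrightarrow>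
       sol_chord (h \<otimes>\<^bsub>Sol\<^esub> \<gamma>1) s \<otimes>\<^bsub>Sol\<^esub> \<delta> \<noteq> sol_chord (h \<otimes>\<^bsub>Sol\<^esub> \<gamma>2) t"
proof -
  obtain x0 y0 z0 where "(x0, y0, z0) \<in> U"
    using assms(3) by (metis all_not_in_conv prod_cases3)
  then obtain A D where AD: "open A" "open D" "x0 \<in> A" "(y0, z0) \<in> D" "A \<times> D \<subseteq> U"
    using open_prod_elim[OF assms(2)] by (metis mem_Sigma_iff)
  then obtain B C where BC: "open B" "open C" "y0 \<in> B" "z0 \<in> C" "B \<times> C \<subseteq> D"
    using open_prod_elim[of D] by (metis mem_Sigma_iff)
  have "countable ((\<lambda>\<gamma>. - snd (snd \<gamma>)) ` G)"
    using assms(1) by simp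
  then obtain z where z: "z \<in> C" "z \<notin> (\<lambda>\<gamma>. - snd (snd \<gamma>)) ` G"
    using open_minus_countable BC by (metis empty_iff)
  define T where "T = {(\<gamma>1, \<gamma>2, \<delta>). \<gamma>1 \<in> G \<and> \<gamma>2 \<in> G \<and> \<delta> \<in> G \<and> snd (snd \<gamma>1) \<noteq> snd (snd \<gamma>2)}"
  have "T \<subseteq> G \<times> G \<times> G"
    unfolding T_def by blast
  then have T: "countable T"
    using assms(1) by (meson countable_SIGMA countable_subset)
  \<comment> \<open>These are the two horizontal coordinates of the meeting equation, with
    \<open>P1\<close> and \<open>P2\<close> the exponentials of the end heights and \<open>k\<close>
    that of the height of \<open>\<delta>\<close>.\<close>
  define ex where "ex = (\<lambda>(\<gamma>1 :: R3, \<gamma>2 :: R3, \<delta> :: R3) x p. (x + exp z * fst \<gamma>1) * ((1 - p) / (1 - exp (z + snd (snd \<gamma>1))))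
        + p * fst \<delta> =
      (x + exp z * fst \<gamma>2) * ((1 - p * exp (snd (snd \<delta>))) / (1 - exp (z + snd (snd \<gamma>2)))))"
  define ey where "ey = (\<lambda>(\<gamma>1 :: R3, \<gamma>2 :: R3, \<delta> :: R3) y p. 
      (y + exp (- z) * fst (snd \<gamma>1)) * ((1 - 1 / p) / (1 - 1 / exp (z + snd (snd \<gamma>1)))) + fst (snd \<delta>) / p =
      (y + exp (- z) * fst (snd \<gamma>2)) *
        ((1 - 1 / (p * exp (snd (snd \<delta>)))) / (1 - 1 / exp (z + snd (snd \<gamma>2)))))"
  define Y where "Y \<tau> x = {y. \<exists>p. p > 0 \<and> p \<noteq> 1 \<and> p \<noteq> exp (z + snd (snd (fst \<tau>))) \<and> ex \<tau> x p \<and> ey \<tau> y p}" for \<tau> x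
  have "\<exists>X. countable X \<and> (\<forall>x. x \<notin> X \<longrightarrow> countable (Y \<tau> x))" if "\<tau> \<in> T" for \<tau>
  proof -
    obtain \<gamma>1 \<gamma>2 \<delta> where \<tau>: "\<tau> = (\<gamma>1, \<gamma>2, \<delta>)"
      by (cases \<tau>)
    have "z + snd (snd \<gamma>) \<noteq> 0" if "\<gamma> \<in> G" for \<gamma>
    proof
      assume "z + snd (snd \<gamma>) = 0"
      then have "z = - snd (snd \<gamma>)"
        by simp
      then show False
        using z(2) that by blast
    qed
    then have "z + snd (snd \<gamma>1) \<noteq> 0" "z + snd (snd \<gamma>2) \<noteq> 0" "snd (snd \<gamma>1) \<noteq> snd (snd \<gamma>2)"
      using that unfolding \<tau> T_def by auto
    then show ?thesis
      unfolding Y_def \<tau> ex_def ey_def prod.case fst_conv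
      by (intro countable_exceptional_values) auto
  qed
  then obtain X where X: "\<And>\<tau>. \<tau> \<in> T \<Longrightarrow> countable (X \<tau>)"
    "\<And>\<tau> x. \<tau> \<in> T \<Longrightarrow> x \<notin> X \<tau> \<Longrightarrow> countable (Y \<tau> x)"
    by metis
  have "countable (\<Union>\<tau>\<in>T. X \<tau>)"
    using T X(1) by blast
  then obtain x where x: "x \<in> A" "x \<notin> (\<Union>\<tau>\<in>T. X \<tau>)"
    using open_minus_countable AD by (metis empty_iff)
  have "countable (\<Union>\<tau>\<in>T. Y \<tau> x)"
    using T X(2) x(2) by blast
  then obtain y where y: "y \<in> B" "y \<notin> (\<Union>\<tau>\<in>T. Y \<tau> x)"
    using open_minus_countable BC by (metis empty_iff)
  show ?thesis
  proof (rule that[of "(x, y, z)"])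
    show "(x, y, z) \<in> U"
      using x y z AD BC by blast
    show nz: "snd (snd ((x, y, z) \<otimes>\<^bsub>Sol\<^esub> \<gamma>)) \<noteq> 0" if "\<gamma> \<in> G" for \<gamma>
      using z(2) that by (cases \<gamma>) (force simp: add_eq_0_iff2)
    fix \<gamma>1 \<gamma>2 \<delta> s t
    assume G: "\<gamma>1 \<in> G" "\<gamma>2 \<in> G" "\<delta> \<in> G" "snd (snd \<gamma>1) \<noteq> snd (snd \<gamma>2)" and s: "0 < s" "s < (1::real)"
    show "sol_chord ((x, y, z) \<otimes>\<^bsub>Sol\<^esub> \<gamma>1) s \<otimes>\<^bsub>Sol\<^esub> \<delta> \<noteq> sol_chord ((x, y, z) \<otimes>\<^bsub>Sol\<^esub> \<gamma>2) t"
    proof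
      assume eq: "sol_chord ((x, y, z) \<otimes>\<^bsub>Sol\<^esub> \<gamma>1) s \<otimes>\<^bsub>Sol\<^esub> \<delta> = sol_chord ((x, y, z) \<otimes>\<^bsub>Sol\<^esub> \<gamma>2) t"
      obtain a1 b1 c1 a2 b2 c2 d e f where abc: "\<gamma>1 = (a1, b1, c1)" "\<gamma>2 = (a2, b2, c2)" "\<delta> = (d, e, f)"
        using prod_cases3 by metis
      define p where "p = exp (s * (z + c1))"
      have c1: "z + c1 \<noteq> 0"
        using nz[OF G(1)] abc by simp
      then have p: "p > 0" "p \<noteq> 1" "p \<noteq> exp (z + c1)"
        using s by (auto simp: p_def)
      \<comment> \<open>The height coordinate eliminates the time \<open>t\<close> on the second
        curve in favour of \<open>p\<close>.\<close>
      have height: "s * (z + c1) + f = t * (z + c2)"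
        using eq by (simp add: abc)
      then have pf: "exp (t * (z + c2)) = p * exp f"
        by (simp add: p_def flip: exp_add)
      have "ex (\<gamma>1, \<gamma>2, \<delta>) x p" "ey (\<gamma>1, \<gamma>2, \<delta>) y p"
        using eq pf unfolding ex_def ey_def by (simp_all add: abc p_def exp_minus inverse_eq_divide)
      then have "y \<in> Y (\<gamma>1, \<gamma>2, \<delta>) x"
        using p unfolding Y_def abc by auto
      then show False
        using y(2) G unfolding T_def by blast
    qed
  qed
qed

section \<open>Heights, cosets and lattice elements of nonzero height\<close>

lemma snd_snd_Sol_mult: "snd (snd (g \<otimes>\<^bsub>Sol\<^esub> h)) = snd (snd g) + snd (snd h)"
  by (cases g; cases h) simp

lemma snd_snd_Sol_inv: "snd (snd (inv\<^bsub>Sol\<^esub> g)) = - snd (snd g)"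
proof -
  have "inv\<^bsub>Sol\<^esub> g \<otimes>\<^bsub>Sol\<^esub> g = \<one>\<^bsub>Sol\<^esub>"
    by (simp add: group.l_inv[OF group_Sol] del: Sol_one)
  then have "snd (snd (inv\<^bsub>Sol\<^esub> g)) + snd (snd g) = 0"
    by (metis Sol_one snd_conv snd_snd_Sol_mult)
  then show ?thesis
    by simp
qed

lemma Sol_l_coset_eqD:
  assumes "subgroup \<Gamma> Sol" "g <#\<^bsub>Sol\<^esub> \<Gamma> = g' <#\<^bsub>Sol\<^esub> \<Gamma>"
  obtains \<gamma> where "\<gamma> \<in> \<Gamma>" "g' = g \<otimes>\<^bsub>Sol\<^esub> \<gamma>"
proof -
  have "g' \<in> g <#\<^bsub>Sol\<^esub> \<Gamma>"
    using group.lcos_self[OF group_Sol _ assms(1), of g'] assms(2) by simp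
  then show ?thesis
    using that unfolding l_coset_def by blast
qed

lemma Sol_l_coset_assoc: "g <#\<^bsub>Sol\<^esub> (h <#\<^bsub>Sol\<^esub> \<Gamma>) = (g \<otimes>\<^bsub>Sol\<^esub> h) <#\<^bsub>Sol\<^esub> \<Gamma>"
  by (rule group.lcos_m_assoc[OF group_Sol]) simp_all

text \<open>
  Otherwise the height descends to the quotient, which is therefore the disjoint union of the
  translates by \<open>(0, 0, n)\<close> of one measurable slab, contradicting finiteness of the measure.
\<close>

lemma Sol_lattice_height_nonzero:
  assumes "Sol_lattice \<Gamma>"
  obtains \<gamma> where "\<gamma> \<in> \<Gamma>" "snd (snd \<gamma>) \<noteq> 0"
proof (rule ccontr)
  assume "\<not> thesis"
  with that have flat: "\<And>\<gamma>. \<gamma> \<in> \<Gamma> \<Longrightarrow> snd (snd \<gamma>) = 0"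
    by blast
  have \<Gamma>: "subgroup \<Gamma> Sol"
    using assms unfolding Sol_lattice_def by blast
  obtain \<mu> where \<mu>: "space \<mu> = lcosets\<^bsub>Sol\<^esub> \<Gamma>"
    "sets \<mu> = sigma_sets (lcosets\<^bsub>Sol\<^esub> \<Gamma>) {U. openin (quotient_topology \<Gamma>) U}"
    "0 < emeasure \<mu> (space \<mu>)" "emeasure \<mu> (space \<mu>) < \<infinity>"
    "\<And>g A. A \<in> sets \<mu> \<Longrightarrow> emeasure \<mu> ((\<lambda>m. g <#\<^bsub>Sol\<^esub> m) ` A) = emeasure \<mu> A"
    using assms unfolding Sol_lattice_def by blast
  interpret finite_measure \<mu>
    using \<mu>(4) by (intro finite_measureI) auto
  define H where "H S = (\<lambda>g. g <#\<^bsub>Sol\<^esub> \<Gamma>) ` {g. snd (snd g) \<in> S}" for S :: "real set"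
  \<comment> \<open>Right multiplication by elements of height 0 preserves height, so the preimage
    of \<open>H S\<close> in Sol is exactly the set of points with height in
    \<open>S\<close>.\<close>
  have mem_H: "g <#\<^bsub>Sol\<^esub> \<Gamma> \<in> H S \<longleftrightarrow> snd (snd g) \<in> S" for g S
  proof
    assume "g <#\<^bsub>Sol\<^esub> \<Gamma> \<in> H S"
    then obtain g' where "snd (snd g') \<in> S" "g <#\<^bsub>Sol\<^esub> \<Gamma> = g' <#\<^bsub>Sol\<^esub> \<Gamma>"
      unfolding H_def by blast
    then show "snd (snd g) \<in> S"
      using flat by (metis Sol_l_coset_eqD[OF \<Gamma>] add.right_neutral snd_snd_Sol_mult)
  qed (auto simp: H_def)
  have H_sub: "H S \<subseteq> lcosets\<^bsub>Sol\<^esub> \<Gamma>" for S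
    unfolding H_def LCOSETS_def Sol_carrier by blast
  have lcosets_cases: "\<exists>g. m = g <#\<^bsub>Sol\<^esub> \<Gamma>" if "m \<in> lcosets\<^bsub>Sol\<^esub> \<Gamma>" for m
    using that unfolding LCOSETS_def Sol_carrier by blast
  have H_diff: "H (S - T) = H S - H T" for S T
  proof (rule Set.set_eqI)
    fix m
    show "m \<in> H (S - T) \<longleftrightarrow> m \<in> H S - H T"
    proof (cases "m \<in> lcosets\<^bsub>Sol\<^esub> \<Gamma>")
      case True
      then obtain g where "m = g <#\<^bsub>Sol\<^esub> \<Gamma>"
        using lcosets_cases by blast
      then show ?thesis
        by (simp add: mem_H)
    qed (use H_sub in blast)
  qed
  have "H S \<in> sets \<mu>" if "open S" for S
  proof -
    have "open {g :: R3. snd (snd g) \<in> S}"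
      using open_vimage[OF that, of "\<lambda>g :: R3. snd (snd g)"]
      by (simp add: vimage_def continuous_on_snd continuous_on_id)
    then have "openin (quotient_topology \<Gamma>) (H S)"
      using H_sub by (simp add: openin_quotient_topology mem_H)
    then show ?thesis
      unfolding \<mu>(2) by blast
  qed
  \<comment> \<open>A half-open interval is a difference of two open rays, whose images are open and
    hence measurable.\<close>
  then have "H ({..<b} - {..<a}) \<in> sets \<mu>" for a b
    unfolding H_diff by (intro sets.Diff) auto
  moreover have "{..<b} - {..<a} = {a..<b}" for a b :: real
    by auto
  ultimately have slab_sets: "H {a..<b} \<in> sets \<mu>" for a b
    by metis
  have "(\<lambda>m. (0, 0, c) <#\<^bsub>Sol\<^esub> m) ` H {0..<1} = H {c..<c + 1}" for c
  proof (intro equalityI subsetI)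
    fix m
    assume "m \<in> (\<lambda>m. (0, 0, c) <#\<^bsub>Sol\<^esub> m) ` H {0..<1}"
    then obtain g where "snd (snd g) \<in> {0..<1}" "m = ((0, 0, c) \<otimes>\<^bsub>Sol\<^esub> g) <#\<^bsub>Sol\<^esub> \<Gamma>"
      unfolding H_def by (auto simp: Sol_l_coset_assoc simp del: Sol_mult)
    then show "m \<in> H {c..<c + 1}"
      by (auto simp: mem_H snd_snd_Sol_mult simp del: Sol_mult)
  next
    fix m
    assume "m \<in> H {c..<c + 1}"
    then obtain g where g: "snd (snd g) \<in> {c..<c + 1}" "m = g <#\<^bsub>Sol\<^esub> \<Gamma>"
      unfolding H_def by blast
    define g' where "g' = (0, 0, - c) \<otimes>\<^bsub>Sol\<^esub> g"
    have "(0, 0, c) \<otimes>\<^bsub>Sol\<^esub> g' = g"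
      by (cases g) (simp add: g'_def exp_minus)
    then have "m = (0, 0, c) <#\<^bsub>Sol\<^esub> (g' <#\<^bsub>Sol\<^esub> \<Gamma>)"
      by (simp only: Sol_l_coset_assoc g(2))
    moreover have "g' <#\<^bsub>Sol\<^esub> \<Gamma> \<in> H {0..<1}"
      using g(1) by (simp add: mem_H g'_def snd_snd_Sol_mult)
    ultimately show "m \<in> (\<lambda>m. (0, 0, c) <#\<^bsub>Sol\<^esub> m) ` H {0..<1}"
      by blast
  qed
  then have translate: "measure \<mu> (H {c..<c + 1}) = measure \<mu> (H {0..<1})" for c
    using \<mu>(5)[OF slab_sets[of 0 1], of "(0, 0, c)"] by (simp add: measure_def)
  have "disjoint_family (\<lambda>n. H {real n..<real n + 1})"
    unfolding disjoint_family_on_def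
  proof (intro ballI impI)
    fix m n :: nat
    assume "m \<noteq> n"
    then show "H {real m..<real m + 1} \<inter> H {real n..<real n + 1} = {}"
      unfolding H_def[of "{real m..<real m + 1}"] by (auto simp: mem_H)
  qed
  then have "(\<lambda>n. measure \<mu> (H {real n..<real n + 1})) sums measure \<mu> (\<Union>n. H {real n..<real n + 1})"
    using slab_sets by (intro finite_measure_UNION) auto
  \<comment> \<open>The disjoint slabs over the naturals all have the same measure, and a constant
    series converges only if its term is 0.\<close>
  then have "measure \<mu> (H {0..<1}) = 0"
    unfolding translate using sums_summable summable_const_iff by blast
  then have "H {real_of_int i..<real_of_int i + 1} \<in> null_sets \<mu>" for i
    using slab_sets translate by (simp add: null_sets_def emeasure_eq_measure)
  \<comment> \<open>The slabs over all integers cover the quotient, which would then be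
    null.\<close>
  then have "(\<Union>i. H {real_of_int i..<real_of_int i + 1}) \<in> null_sets \<mu>"
    by (rule null_sets_UN)
  moreover have "(\<Union>i. H {real_of_int i..<real_of_int i + 1}) = space \<mu>"
  proof (intro equalityI subsetI)
    fix m
    assume "m \<in> space \<mu>"
    then obtain g where "m = g <#\<^bsub>Sol\<^esub> \<Gamma>"
      using \<mu>(1) lcosets_cases by blast
    then have "m \<in> H {real_of_int \<lfloor>snd (snd g)\<rfloor>..<real_of_int \<lfloor>snd (snd g)\<rfloor> + 1}"
      by (simp add: mem_H)
    then show "m \<in> (\<Union>i. H {real_of_int i..<real_of_int i + 1})"
      by blast
  qed (use H_sub \<mu>(1) in blast)
  ultimately show False
    using \<mu>(3) by (simp add: null_sets_def)
qed

section \<open>Non-blockable pairs and their density\<close>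

text \<open>Powers of \<open>\<gamma>\<close> provide connecting curves with pairwise different end
  heights. A finite blocking set would meet two of them in the same point, which
  \<open>disjoint\<close> forbids.\<close>

lemma generic_pair_not_blockable:
  fixes a h :: R3
  assumes \<Gamma>: "subgroup \<Gamma> Sol" and \<gamma>: "\<gamma> \<in> \<Gamma>" "snd (snd \<gamma>) \<noteq> 0"
  defines "G \<equiv> (\<lambda>\<gamma>. a \<otimes>\<^bsub>Sol\<^esub> \<gamma> \<otimes>\<^bsub>Sol\<^esub> inv\<^bsub>Sol\<^esub> a) ` \<Gamma>"
  assumes height: "\<And>\<gamma>. \<gamma> \<in> G \<Longrightarrow> snd (snd (h \<otimes>\<^bsub>Sol\<^esub> \<gamma>)) \<noteq> 0"
    and disjoint: "\<And>\<gamma>1 \<gamma>2 \<delta> s t. \<gamma>1 \<in> G \<Longrightarrow> \<gamma>2 \<in> G \<Longrightarrow> \<delta> \<in> G \<Longrightarrow>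
       snd (snd \<gamma>1) \<noteq> snd (snd \<gamma>2) \<Longrightarrow> 0 < s \<Longrightarrow> s < 1 \<Longrightarrow>
       sol_chord (h \<otimes>\<^bsub>Sol\<^esub> \<gamma>1) s \<otimes>\<^bsub>Sol\<^esub> \<delta> \<noteq> sol_chord (h \<otimes>\<^bsub>Sol\<^esub> \<gamma>2) t"
  shows "\<not> blockable_pair \<Gamma> (a <#\<^bsub>Sol\<^esub> \<Gamma>) ((h \<otimes>\<^bsub>Sol\<^esub> a) <#\<^bsub>Sol\<^esub> \<Gamma>)"
proof
  interpret Sol: group Sol
    by (rule group_Sol)
  let ?m1 = "a <#\<^bsub>Sol\<^esub> \<Gamma>" and ?m2 = "(h \<otimes>\<^bsub>Sol\<^esub> a) <#\<^bsub>Sol\<^esub> \<Gamma>"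
  assume "blockable_pair \<Gamma> ?m1 ?m2"
  then obtain B where B: "finite B" "?m1 \<notin> B" "?m2 \<notin> B"
    "\<And>c. connecting_curve ?m1 ?m2 c \<Longrightarrow> c ` {0..1} \<inter> B \<noteq> {}"
    unfolding blockable_pair_def blocking_set_def by blast
  define conj where "conj g = a \<otimes>\<^bsub>Sol\<^esub> g \<otimes>\<^bsub>Sol\<^esub> inv\<^bsub>Sol\<^esub> a" for g
  have conj_G: "conj g \<in> G" if "g \<in> \<Gamma>" for g
    using that unfolding G_def conj_def by blast
  \<comment> \<open>This makes \<open>h \<otimes> conj g\<close> carry \<open>?m1\<close> to
    \<open>?m2\<close>: applied to \<open>a\<close> it gives
    \<open>h \<otimes> a \<otimes> g\<close>, which represents \<open>?m2\<close>.\<close>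
  have conj_a: "conj g \<otimes>\<^bsub>Sol\<^esub> a = a \<otimes>\<^bsub>Sol\<^esub> g" for g
    by (simp add: conj_def Sol.m_assoc del: Sol_one Sol_mult)
  have height_conj: "snd (snd (conj g)) = snd (snd g)" for g
    by (simp add: conj_def snd_snd_Sol_mult snd_snd_Sol_inv)
  have hits: "\<exists>t. 0 < t \<and> t < 1 \<and> sol_chord (h \<otimes>\<^bsub>Sol\<^esub> conj g) t <#\<^bsub>Sol\<^esub> ?m1 \<in> B" if g: "g \<in> \<Gamma>" for g
  proof -
    obtain v where v: "\<And>t. Sol_exp (t *\<^sub>R v) = sol_chord (h \<otimes>\<^bsub>Sol\<^esub> conj g) t"
      "Sol_exp (0 *\<^sub>R v) = \<one>\<^bsub>Sol\<^esub>" "Sol_exp (1 *\<^sub>R v) = h \<otimes>\<^bsub>Sol\<^esub> conj g"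
      using Sol_exp_sol_chord[OF height[OF conj_G[OF g]]] by metis
    define c where "c t = Sol_exp (t *\<^sub>R v) <#\<^bsub>Sol\<^esub> ?m1" for t
    have c0: "c 0 = ?m1"
      unfolding c_def v(2) by (rule Sol.lcos_mult_one) simp
    have "g <#\<^bsub>Sol\<^esub> \<Gamma> = \<Gamma>"
      by (rule Sol.coset_join3) (use g \<Gamma> in simp_all)
    then have "(h \<otimes>\<^bsub>Sol\<^esub> (a \<otimes>\<^bsub>Sol\<^esub> g)) <#\<^bsub>Sol\<^esub> \<Gamma> = ?m2"
      by (metis Sol_l_coset_assoc)
    then have c1: "c 1 = ?m2"
      unfolding c_def v(3) Sol_l_coset_assoc by (simp add: Sol.m_assoc conj_a del: Sol_one Sol_mult)
    have "connecting_curve ?m1 ?m2 c"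
      unfolding connecting_curve_def using c0 c1 c_def by blast
    then obtain t where t: "t \<in> {0..1}" "c t \<in> B"
      using B(4) by blast
    \<comment> \<open>A blocking set excludes both endpoints, so the hit occurs at an interior time,
      as \<open>disjoint\<close> requires.\<close>
    then have "t \<noteq> 0" "t \<noteq> 1"
      using c0 c1 B(2,3) by metis+
    then show ?thesis
      using t unfolding c_def v(1) by (intro exI[of _ t]) auto
  qed
  have "\<exists>g\<in>\<Gamma>. snd (snd g) = real n * snd (snd \<gamma>)" for n
  proof (induction n)
    case 0
    show ?case
      using subgroup.one_closed[OF \<Gamma>] by (intro bexI[of _ "\<one>\<^bsub>Sol\<^esub>"]) simp_all
  next
    case (Suc n)
    then obtain g where "g \<in> \<Gamma>" "snd (snd g) = real n * snd (snd \<gamma>)"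
      by blast
    then show ?case
      using subgroup.m_closed[OF \<Gamma> _ \<gamma>(1)]
      by (intro bexI[of _ "g \<otimes>\<^bsub>Sol\<^esub> \<gamma>"]) (simp_all add: snd_snd_Sol_mult algebra_simps)
  qed
  then obtain g where g: "\<And>n. g n \<in> \<Gamma>" "\<And>n. snd (snd (g n)) = real n * snd (snd \<gamma>)"
    by metis
  obtain t where t: "\<And>n. 0 < t n" "\<And>n. t n < 1"
    "\<And>n. sol_chord (h \<otimes>\<^bsub>Sol\<^esub> conj (g n)) (t n) <#\<^bsub>Sol\<^esub> ?m1 \<in> B"
    using hits[OF g(1)] by metis
  define b where "b n = sol_chord (h \<otimes>\<^bsub>Sol\<^esub> conj (g n)) (t n) <#\<^bsub>Sol\<^esub> ?m1" for n
  have "range b \<subseteq> B"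
    using t(3) b_def by auto
  then have "\<not> inj b"
    using B(1) finite_imageD finite_subset infinite_UNIV_nat by blast
  then obtain m n where mn: "m \<noteq> n" "b m = b n"
    unfolding inj_on_def by blast
  let ?p = "sol_chord (h \<otimes>\<^bsub>Sol\<^esub> conj (g m)) (t m)" and ?q = "sol_chord (h \<otimes>\<^bsub>Sol\<^esub> conj (g n)) (t n)"
  \<comment> \<open>Equality of the two points of the quotient yields a lattice element
    \<open>\<delta>\<close>; cancelling \<open>a\<close> turns it into
    \<open>conj \<delta>\<close>.\<close>
  have "(?p \<otimes>\<^bsub>Sol\<^esub> a) <#\<^bsub>Sol\<^esub> \<Gamma> = (?q \<otimes>\<^bsub>Sol\<^esub> a) <#\<^bsub>Sol\<^esub> \<Gamma>"
    using mn(2) by (simp add: b_def Sol_l_coset_assoc)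
  then obtain \<delta> where \<delta>: "\<delta> \<in> \<Gamma>" "?q \<otimes>\<^bsub>Sol\<^esub> a = ?p \<otimes>\<^bsub>Sol\<^esub> a \<otimes>\<^bsub>Sol\<^esub> \<delta>"
    using Sol_l_coset_eqD[OF \<Gamma>] by metis
  have "?q \<otimes>\<^bsub>Sol\<^esub> a = ?p \<otimes>\<^bsub>Sol\<^esub> conj \<delta> \<otimes>\<^bsub>Sol\<^esub> a"
    unfolding \<delta>(2) by (simp add: Sol.m_assoc conj_a del: Sol_one Sol_mult)
  then have "?q = ?p \<otimes>\<^bsub>Sol\<^esub> conj \<delta>"
    by (rule Sol.right_cancel[THEN iffD1, rotated -1]) simp_all
  moreover have "snd (snd (conj (g m))) \<noteq> snd (snd (conj (g n)))"
    using mn(1) \<gamma>(2) by (simp add: height_conj g(2))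
  ultimately show False
    using disjoint[of "conj (g m)" "conj (g n)" "conj \<delta>"] conj_G g(1) \<delta>(1) t(1,2) by metis
qed

text \<open>Right translation by \<open>a\<close> is continuous and surjective, so a generic
  \<open>h\<close> can be found with \<open>h \<otimes> a\<close> in \<open>U\<close>. The first
  point stays arbitrary, so density needs only a perturbation of the second.\<close>

lemma exists_not_blockable_pair:
  fixes a :: R3
  assumes "Sol_lattice \<Gamma>" and U: "open U" "U \<noteq> {}"
  obtains g where "g \<in> U" "\<not> blockable_pair \<Gamma> (a <#\<^bsub>Sol\<^esub> \<Gamma>) (g <#\<^bsub>Sol\<^esub> \<Gamma>)"
proof -
  interpret Sol: group Sol
    by (rule group_Sol)
  have \<Gamma>: "subgroup \<Gamma> Sol" "discrete \<Gamma>"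
    using assms(1) unfolding Sol_lattice_def by blast+
  obtain \<gamma> where \<gamma>: "\<gamma> \<in> \<Gamma>" "snd (snd \<gamma>) \<noteq> 0"
    using Sol_lattice_height_nonzero[OF assms(1)] .
  define G where "G = (\<lambda>\<gamma>. a \<otimes>\<^bsub>Sol\<^esub> \<gamma> \<otimes>\<^bsub>Sol\<^esub> inv\<^bsub>Sol\<^esub> a) ` \<Gamma>"
  have "countable G"
    unfolding G_def using countable_discrete[OF \<Gamma>(2)] by simp
  obtain a1 a2 a3 where a: "a = (a1, a2, a3)"
    by (cases a)
  have "(\<lambda>h. h \<otimes>\<^bsub>Sol\<^esub> a) = (\<lambda>h. (fst h + exp (snd (snd h)) * a1,
      fst (snd h) + exp (- snd (snd h)) * a2, snd (snd h) + a3))"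
    by (auto simp: a)
  then have "continuous_on UNIV (\<lambda>h. h \<otimes>\<^bsub>Sol\<^esub> a)"
    by (simp only:) (intro continuous_intros)
  then have V: "open ((\<lambda>h. h \<otimes>\<^bsub>Sol\<^esub> a) -` U)"
    by (rule open_vimage[OF U(1)])
  obtain u where "u \<in> U"
    using U(2) by blast
  then have "u \<otimes>\<^bsub>Sol\<^esub> inv\<^bsub>Sol\<^esub> a \<in> (\<lambda>h. h \<otimes>\<^bsub>Sol\<^esub> a) -` U"
    by (simp add: Sol.m_assoc del: Sol_one Sol_mult)
  then have V': "(\<lambda>h. h \<otimes>\<^bsub>Sol\<^esub> a) -` U \<noteq> {}"
    by blast
  show ?thesis
  proof (rule exists_generic_endpoint[OF \<open>countable G\<close> V V'], goal_cases)
    case (1 h)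
    have "\<not> blockable_pair \<Gamma> (a <#\<^bsub>Sol\<^esub> \<Gamma>) ((h \<otimes>\<^bsub>Sol\<^esub> a) <#\<^bsub>Sol\<^esub> \<Gamma>)"
      using generic_pair_not_blockable[OF \<Gamma>(1) \<gamma>, of a h] 1(2,3) unfolding G_def by blast
    then show ?thesis
      using that 1(1) by blast
  qed
qed

theorem theorem1:
  fixes \<Gamma> :: "R3 set"
  assumes "Sol_lattice \<Gamma>"
  shows "\<not> blockable \<Gamma> \<and>
    prod_topology (quotient_topology \<Gamma>) (quotient_topology \<Gamma>) closure_of
      {(m1, m2). m1 \<in> lcosets\<^bsub>Sol\<^esub> \<Gamma> \<and> m2 \<in> lcosets\<^bsub>Sol\<^esub> \<Gamma> \<and> \<not> blockable_pair \<Gamma> m1 m2}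
    = (lcosets\<^bsub>Sol\<^esub> \<Gamma>) \<times> (lcosets\<^bsub>Sol\<^esub> \<Gamma>)"
    (is "_ \<and> ?X closure_of ?N = _")
proof
  have in_lcosets: "g <#\<^bsub>Sol\<^esub> \<Gamma> \<in> lcosets\<^bsub>Sol\<^esub> \<Gamma>" for g
    unfolding LCOSETS_def Sol_carrier by blast
  show "\<not> blockable \<Gamma>"
  proof
    assume "blockable \<Gamma>"
    moreover obtain g where "\<not> blockable_pair \<Gamma> (\<one>\<^bsub>Sol\<^esub> <#\<^bsub>Sol\<^esub> \<Gamma>) (g <#\<^bsub>Sol\<^esub> \<Gamma>)"
      using exists_not_blockable_pair[OF assms, of UNIV] by blast
    ultimately show False
      using in_lcosets unfolding blockable_def by blast
  qed
  have "(m1, m2) \<in> ?X closure_of ?N" if m: "m1 \<in> lcosets\<^bsub>Sol\<^esub> \<Gamma>" "m2 \<in> lcosets\<^bsub>Sol\<^esub> \<Gamma>" for m1 m2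
    unfolding in_closure_of
  proof (intro conjI allI impI)
    show "(m1, m2) \<in> topspace ?X"
      using m by simp
    fix T
    assume T: "(m1, m2) \<in> T \<and> openin ?X T"
    then obtain U V where UV: "openin (quotient_topology \<Gamma>) U" "openin (quotient_topology \<Gamma>) V"
      "m1 \<in> U" "m2 \<in> V" "U \<times> V \<subseteq> T"
      unfolding openin_prod_topology_alt by blast
    obtain g1 g2 where g: "m1 = g1 <#\<^bsub>Sol\<^esub> \<Gamma>" "m2 = g2 <#\<^bsub>Sol\<^esub> \<Gamma>"
      using m unfolding LCOSETS_def Sol_carrier by blast
    \<comment> \<open>The preimage of \<open>V\<close> in Sol is where the second representative is
      moved; \<open>m1\<close> is kept.\<close>
    have "open {g. g <#\<^bsub>Sol\<^esub> \<Gamma> \<in> V}" "{g. g <#\<^bsub>Sol\<^esub> \<Gamma> \<in> V} \<noteq> {}"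
      using UV(2,4) g(2) unfolding openin_quotient_topology by blast+
    then obtain g where "g <#\<^bsub>Sol\<^esub> \<Gamma> \<in> V" "\<not> blockable_pair \<Gamma> m1 (g <#\<^bsub>Sol\<^esub> \<Gamma>)"
      using exists_not_blockable_pair[OF assms] g(1) by (metis mem_Collect_eq)
    then show "\<exists>y. y \<in> ?N \<and> y \<in> T"
      using UV m(1) in_lcosets by blast
  qed
  then show "?X closure_of ?N = (lcosets\<^bsub>Sol\<^esub> \<Gamma>) \<times> (lcosets\<^bsub>Sol\<^esub> \<Gamma>)"
    using closure_of_subset_topspace[of ?X ?N] by auto
qed

end
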